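(* Let $M$ be an isometrically immersed submanifold of a metallic Riemannian manifold $(\bar M,J,g)$ with $J^2=pJ+qI$. If $M$ is slant with slant angle $\theta$, then $$g(TX,TY)=\cos^2(\theta)\,[p\,g(X,JY)+q\,g(X,Y)]$$ and $$g(NX,NY)=\sin^2(\theta)\,[p\,g(X,JY)+q\,g(X,Y)]$$ for any $X,Y\in\Gamma(TM)$.
   Context: A metallic Riemannian manifold $(\bar M,J,g)$ is a smooth manifold with a $(1,1)$-tensor field $J$ satisfying $J^2=pJ+qI$ for some positive integers $p,q$ and a Riemannian metric $g$ with $g(JX,Y)=g(X,JY)$ for all vector fields $X,Y$. For $X\in\Gamma(TM)$, $TX:=(JX)^T$ and $NX:=(JX)^\perp$ are the components of $JX$ tangent and normal to $M$. $M$ is slant if for all $x\in M$ and nonzero $X_x\in T_xM$ the angle $\theta(X_x)\in[0,\pi/2]$ between $JX_x$ and $T_xM$ is a constant $\theta$ (independent of $x$ and $X_x$), called the slant angle; one has $\cos\theta(X_x)=\|TX_x\|/\|JX_x\|$. *)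

theory Defs
  imports "HOL-Analysis.Analysis" "HOL-Library.Function_Algebras"
begin

section \<open>Functions into a real vector space\<close>

instantiation "fun" :: (type, scaleR) scaleR
begin

definition scaleR_fun_def: "a *\<^sub>R f = (\<lambda>x. a *\<^sub>R f x)"

instance ..

end

lemma scaleR_fun_apply [simp]: "(a *\<^sub>R f) x = a *\<^sub>R f x"
  by (simp add: scaleR_fun_def)

instance "fun" :: (type, real_vector) real_vector
  by standard (simp_all add: fun_eq_iff scaleR_add_right scaleR_add_left)


section \<open>Smooth maps between open subsets of normed spaces\<close>

text \<open>Only used for open \<open>S\<close>, where the Frechet derivative is unique.\<close>

fun Ck_on :: "nat \<Rightarrow> 'a::real_normed_vector set \<Rightarrow> ('a \<Rightarrow> 'b::real_normed_vector) \<Rightarrow> bool" where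
  "Ck_on 0 S f \<longleftrightarrow> continuous_on S f"
| "Ck_on (Suc k) S f \<longleftrightarrow>
     (\<forall>x\<in>S. f differentiable (at x)) \<and> (\<forall>v. Ck_on k S (\<lambda>x. frechet_derivative f (at x) v))"

definition smooth_on :: "'a::real_normed_vector set \<Rightarrow> ('a \<Rightarrow> 'b::real_normed_vector) \<Rightarrow> bool" where
  "smooth_on S f \<longleftrightarrow> (\<forall>k. Ck_on k S f)"


section \<open>Smooth manifolds\<close>

text \<open>A chart is a coordinate domain together with a coordinate map, whose values outside the
  domain are irrelevant. The dimension of a manifold is \<open>DIM('e)\<close>; the smooth structure is given
  by an atlas, which need not be maximal.\<close>

type_synonym ('p, 'e) chart = "'p set \<times> ('p \<Rightarrow> 'e)"

record ('p, 'e) manifold =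
  mtop :: "'p topology"
  atlas :: "('p, 'e) chart set"

definition chart_inv :: "('p, 'e) chart \<Rightarrow> 'e \<Rightarrow> 'p" where
  "chart_inv c = inv_into (fst c) (snd c)"

definition chart_on :: "'p topology \<Rightarrow> ('p, 'e::euclidean_space) chart \<Rightarrow> bool" where
  "chart_on X c \<longleftrightarrow>
     openin X (fst c) \<and> open (snd c ` fst c) \<and>
     homeomorphic_map (subtopology X (fst c)) (top_of_set (snd c ` fst c)) (snd c)"

definition smooth_manifold :: "('p, 'e::euclidean_space) manifold \<Rightarrow> bool" where
  "smooth_manifold M \<longleftrightarrow>
     Hausdorff_space (mtop M) \<and> second_countable (mtop M) \<and>
     (\<forall>c\<in>atlas M. chart_on (mtop M) c) \<and>
     (\<Union>c\<in>atlas M. fst c) = topspace (mtop M) \<and>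
     (\<forall>c\<in>atlas M. \<forall>d\<in>atlas M. smooth_on (snd c ` (fst c \<inter> fst d)) (snd d \<circ> chart_inv c))"

definition charts_at :: "('p, 'e) manifold \<Rightarrow> 'p \<Rightarrow> ('p, 'e) chart set" where
  "charts_at M x = {c \<in> atlas M. x \<in> fst c}"


section \<open>Tangent vectors and tensor fields\<close>

text \<open>A tangent vector at \<open>x\<close> is a family of coordinate vectors, one for each chart around \<open>x\<close>,
  that transforms by the derivatives of the transition maps. The entries at all other charts are
  set to \<open>0\<close>, so that the tangent space is a linear subspace of a function space.\<close>

type_synonym ('p, 'e) tvec = "('p, 'e) chart \<Rightarrow> 'e"

definition tangent_space ::
  "('p, 'e::euclidean_space) manifold \<Rightarrow> 'p \<Rightarrow> ('p, 'e) tvec set" where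
  "tangent_space M x =
     {v. (\<forall>c. c \<notin> charts_at M x \<longrightarrow> v c = 0) \<and>
         (\<forall>c\<in>charts_at M x. \<forall>d\<in>charts_at M x.
            v d = frechet_derivative (snd d \<circ> chart_inv c) (at (snd c x)) (v c))}"

text \<open>The tangent vector at \<open>x\<close> whose coordinates in the chart \<open>c\<close> are \<open>a\<close>.\<close>

definition coord_tvec ::
  "('p, 'e::euclidean_space) manifold \<Rightarrow> ('p, 'e) chart \<Rightarrow> 'p \<Rightarrow> 'e \<Rightarrow> ('p, 'e) tvec" where
  "coord_tvec M c x a =
     (\<lambda>d. if d \<in> charts_at M x
          then frechet_derivative (snd d \<circ> chart_inv c) (at (snd c x)) a else 0)"

definition vector_field ::
  "('p, 'e::euclidean_space) manifold \<Rightarrow> ('p \<Rightarrow> ('p, 'e) tvec) \<Rightarrow> bool" where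
  "vector_field M X \<longleftrightarrow>
     (\<forall>x\<in>topspace (mtop M). X x \<in> tangent_space M x) \<and>
     (\<forall>c\<in>atlas M. smooth_on (snd c ` fst c) (\<lambda>y. X (chart_inv c y) c))"

definition linear_between ::
  "'v::real_vector set \<Rightarrow> 'w::real_vector set \<Rightarrow> ('v \<Rightarrow> 'w) \<Rightarrow> bool" where
  "linear_between V W h \<longleftrightarrow>
     (\<forall>u\<in>V. h u \<in> W) \<and>
     (\<forall>u\<in>V. \<forall>v\<in>V. h (u + v) = h u + h v) \<and>
     (\<forall>a. \<forall>u\<in>V. h (a *\<^sub>R u) = a *\<^sub>R h u)"

text \<open>Smoothness of a tensor field is smoothness of its components in every chart.\<close>

definition tensor_field_1_1 ::
  "('p, 'e::euclidean_space) manifold \<Rightarrow> ('p \<Rightarrow> ('p, 'e) tvec \<Rightarrow> ('p, 'e) tvec) \<Rightarrow> bool" where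
  "tensor_field_1_1 M J \<longleftrightarrow>
     (\<forall>x\<in>topspace (mtop M). linear_between (tangent_space M x) (tangent_space M x) (J x)) \<and>
     (\<forall>c\<in>atlas M. \<forall>a. smooth_on (snd c ` fst c)
        (\<lambda>y. J (chart_inv c y) (coord_tvec M c (chart_inv c y) a) c))"

definition riemannian_metric ::
  "('p, 'e::euclidean_space) manifold \<Rightarrow>
   ('p \<Rightarrow> ('p, 'e) tvec \<Rightarrow> ('p, 'e) tvec \<Rightarrow> real) \<Rightarrow> bool" where
  "riemannian_metric M g \<longleftrightarrow>
     (\<forall>x\<in>topspace (mtop M).
        (\<forall>u\<in>tangent_space M x. linear_between (tangent_space M x) UNIV (g x u)) \<and>
        (\<forall>u\<in>tangent_space M x. \<forall>v\<in>tangent_space M x. g x u v = g x v u) \<and>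
        (\<forall>u\<in>tangent_space M x. u \<noteq> 0 \<longrightarrow> g x u u > 0)) \<and>
     (\<forall>c\<in>atlas M. \<forall>a b. smooth_on (snd c ` fst c)
        (\<lambda>y. g (chart_inv c y) (coord_tvec M c (chart_inv c y) a)
                               (coord_tvec M c (chart_inv c y) b)))"

definition riemannian_manifold ::
  "('p, 'e::euclidean_space) manifold \<Rightarrow>
   ('p \<Rightarrow> ('p, 'e) tvec \<Rightarrow> ('p, 'e) tvec \<Rightarrow> real) \<Rightarrow> bool" where
  "riemannian_manifold M g \<longleftrightarrow> smooth_manifold M \<and> riemannian_metric M g"


section \<open>Isometric immersions\<close>

definition smooth_map ::
  "('p, 'e::euclidean_space) manifold \<Rightarrow> ('q, 'f::euclidean_space) manifold \<Rightarrow>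
   ('p \<Rightarrow> 'q) \<Rightarrow> bool" where
  "smooth_map M N f \<longleftrightarrow>
     continuous_map (mtop M) (mtop N) f \<and>
     (\<forall>c\<in>atlas M. \<forall>d\<in>atlas N.
        smooth_on (snd c ` (fst c \<inter> f -` fst d)) (snd d \<circ> f \<circ> chart_inv c))"

text \<open>For a smooth map and a tangent vector \<open>v\<close> at \<open>x\<close>, the value does not depend on the chosen
  chart \<open>c\<close> around \<open>x\<close>.\<close>

definition differential ::
  "('p, 'e::euclidean_space) manifold \<Rightarrow> ('q, 'f::euclidean_space) manifold \<Rightarrow>
   ('p \<Rightarrow> 'q) \<Rightarrow> 'p \<Rightarrow> ('p, 'e) tvec \<Rightarrow> ('q, 'f) tvec" where
  "differential M N f x v =
     (let c = (SOME c. c \<in> charts_at M x) in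
      (\<lambda>d. if d \<in> charts_at N (f x)
           then frechet_derivative (snd d \<circ> f \<circ> chart_inv c) (at (snd c x)) (v c) else 0))"

definition immersion ::
  "('p, 'e::euclidean_space) manifold \<Rightarrow> ('q, 'f::euclidean_space) manifold \<Rightarrow>
   ('p \<Rightarrow> 'q) \<Rightarrow> bool" where
  "immersion M N f \<longleftrightarrow>
     smooth_map M N f \<and>
     (\<forall>x\<in>topspace (mtop M). inj_on (differential M N f x) (tangent_space M x))"

definition isometric_immersion ::
  "('p, 'e::euclidean_space) manifold \<Rightarrow> ('p \<Rightarrow> ('p, 'e) tvec \<Rightarrow> ('p, 'e) tvec \<Rightarrow> real) \<Rightarrow>
   ('q, 'f::euclidean_space) manifold \<Rightarrow> ('q \<Rightarrow> ('q, 'f) tvec \<Rightarrow> ('q, 'f) tvec \<Rightarrow> real) \<Rightarrow>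
   ('p \<Rightarrow> 'q) \<Rightarrow> bool" where
  "isometric_immersion M h N g f \<longleftrightarrow>
     riemannian_manifold M h \<and> riemannian_manifold N g \<and> immersion M N f \<and>
     (\<forall>x\<in>topspace (mtop M). \<forall>u\<in>tangent_space M x. \<forall>v\<in>tangent_space M x.
        g (f x) (differential M N f x u) (differential M N f x v) = h x u v)"

text \<open>\<open>T\<^sub>xM\<close>, viewed as a subspace of the tangent space of the ambient manifold at \<open>f x\<close>.\<close>

definition tangent_image ::
  "('p, 'e::euclidean_space) manifold \<Rightarrow> ('q, 'f::euclidean_space) manifold \<Rightarrow>
   ('p \<Rightarrow> 'q) \<Rightarrow> 'p \<Rightarrow> ('q, 'f) tvec set" where
  "tangent_image M N f x = differential M N f x ` tangent_space M x"


section \<open>Metallic Riemannian manifolds and slant submanifolds\<close>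

text \<open>Identities between tensor fields are stated pointwise, on tangent vectors.\<close>

definition metallic_riemannian_manifold ::
  "('q, 'f::euclidean_space) manifold \<Rightarrow> nat \<Rightarrow> nat \<Rightarrow>
   ('q \<Rightarrow> ('q, 'f) tvec \<Rightarrow> ('q, 'f) tvec) \<Rightarrow>
   ('q \<Rightarrow> ('q, 'f) tvec \<Rightarrow> ('q, 'f) tvec \<Rightarrow> real) \<Rightarrow> bool" where
  "metallic_riemannian_manifold N p q J g \<longleftrightarrow>
     p > 0 \<and> q > 0 \<and> riemannian_manifold N g \<and> tensor_field_1_1 N J \<and>
     (\<forall>y\<in>topspace (mtop N). \<forall>v\<in>tangent_space N y.
        J y (J y v) = real p *\<^sub>R J y v + real q *\<^sub>R v) \<and>
     (\<forall>y\<in>topspace (mtop N). \<forall>u\<in>tangent_space N y. \<forall>v\<in>tangent_space N y.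
        g y (J y u) v = g y u (J y v))"

text \<open>In the following, \<open>b\<close> is an inner product on a vector space containing the subspace \<open>S\<close>.\<close>

definition tangential_part ::
  "('v::real_vector \<Rightarrow> 'v \<Rightarrow> real) \<Rightarrow> 'v set \<Rightarrow> 'v \<Rightarrow> 'v" where
  "tangential_part b S v = (THE w. w \<in> S \<and> (\<forall>u\<in>S. b (v - w) u = 0))"

definition normal_part ::
  "('v::real_vector \<Rightarrow> 'v \<Rightarrow> real) \<Rightarrow> 'v set \<Rightarrow> 'v \<Rightarrow> 'v" where
  "normal_part b S v = v - tangential_part b S v"

definition angle :: "('v::real_vector \<Rightarrow> 'v \<Rightarrow> real) \<Rightarrow> 'v \<Rightarrow> 'v \<Rightarrow> real" where
  "angle b v w = arccos (b v w / (sqrt (b v v) * sqrt (b w w)))"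

text \<open>The angle between a nonzero vector and a nonzero subspace is the smallest angle that the
  vector forms with a nonzero vector of the subspace; it lies in \<open>[0, \<pi>/2]\<close>.\<close>

definition angle_subspace :: "('v::real_vector \<Rightarrow> 'v \<Rightarrow> real) \<Rightarrow> 'v \<Rightarrow> 'v set \<Rightarrow> real" where
  "angle_subspace b v S = (INF w\<in>S - {0}. angle b v w)"

definition slant_submanifold ::
  "('p, 'e::euclidean_space) manifold \<Rightarrow> ('q, 'f::euclidean_space) manifold \<Rightarrow> ('p \<Rightarrow> 'q) \<Rightarrow>
   ('q \<Rightarrow> ('q, 'f) tvec \<Rightarrow> ('q, 'f) tvec) \<Rightarrow>
   ('q \<Rightarrow> ('q, 'f) tvec \<Rightarrow> ('q, 'f) tvec \<Rightarrow> real) \<Rightarrow> real \<Rightarrow> bool" where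
  "slant_submanifold M N f J g \<theta> \<longleftrightarrow>
     \<theta> \<in> {0..pi/2} \<and>
     (\<forall>x\<in>topspace (mtop M). \<forall>u\<in>tangent_space M x. u \<noteq> 0 \<longrightarrow>
        angle_subspace (g (f x)) (J (f x) (differential M N f x u)) (tangent_image M N f x) = \<theta>)"

text \<open>The operators \<open>T\<close> and \<open>N\<close> applied to a vector field \<open>X\<close> of the submanifold, with values at
  \<open>x\<close> in the ambient tangent space at \<open>f x\<close>.\<close>

definition T_op ::
  "('p, 'e::euclidean_space) manifold \<Rightarrow> ('q, 'f::euclidean_space) manifold \<Rightarrow> ('p \<Rightarrow> 'q) \<Rightarrow>
   ('q \<Rightarrow> ('q, 'f) tvec \<Rightarrow> ('q, 'f) tvec) \<Rightarrow>
   ('q \<Rightarrow> ('q, 'f) tvec \<Rightarrow> ('q, 'f) tvec \<Rightarrow> real) \<Rightarrow>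
   ('p \<Rightarrow> ('p, 'e) tvec) \<Rightarrow> 'p \<Rightarrow> ('q, 'f) tvec" where
  "T_op M N f J g X x =
     tangential_part (g (f x)) (tangent_image M N f x) (J (f x) (differential M N f x (X x)))"

definition N_op ::
  "('p, 'e::euclidean_space) manifold \<Rightarrow> ('q, 'f::euclidean_space) manifold \<Rightarrow> ('p \<Rightarrow> 'q) \<Rightarrow>
   ('q \<Rightarrow> ('q, 'f) tvec \<Rightarrow> ('q, 'f) tvec) \<Rightarrow>
   ('q \<Rightarrow> ('q, 'f) tvec \<Rightarrow> ('q, 'f) tvec \<Rightarrow> real) \<Rightarrow>
   ('p \<Rightarrow> ('p, 'e) tvec) \<Rightarrow> 'p \<Rightarrow> ('q, 'f) tvec" where
  "N_op M N f J g X x =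
     normal_part (g (f x)) (tangent_image M N f x) (J (f x) (differential M N f x (X x)))"

end

theory Submission
  imports Defs
begin

text \<open>
  At a point \<open>x\<close> the claim is linear algebra in the tangent space \<open>V\<close> of the ambient manifold at
  \<open>f x\<close>, with its inner product \<open>b\<close>, its self-adjoint operator \<open>J\<close> and the image \<open>S\<close> of the
  differential. If \<open>P\<close> is the orthogonal projection onto \<open>S\<close>, then Cauchy-Schwarz gives
  \<open>b v w = b (P v) w \<le> \<parallel>P v\<parallel> \<parallel>w\<parallel>\<close> for \<open>w \<in> S\<close>, so the smallest angle between \<open>v\<close> and \<open>S\<close> has
  cosine \<open>\<parallel>P v\<parallel> / \<parallel>v\<parallel>\<close> (\<open>cos_angle_subspace\<close>). Slantness therefore says
  \<open>\<parallel>P (J w)\<parallel>\<^sup>2 = cos\<^sup>2 \<theta> \<parallel>J w\<parallel>\<^sup>2\<close> for every \<open>w \<in> S\<close>. Both sides are quadratic forms on \<open>S\<close>, so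
  by polarization their bilinear forms agree, and \<open>b (J u) (J v) = b u (J (J v)) =
  p b u (J v) + q b u v\<close> turns this into the first formula. The second one is the first
  subtracted from \<open>b (J u) (J v) = b (P (J u)) (P (J v)) + b ((I - P) (J u)) ((I - P) (J v))\<close>
  (\<open>slant_projection_identities\<close>).

  What the manifold contributes is that \<open>S\<close> is a finite-dimensional subspace of \<open>V\<close>. The chain
  rule puts it inside \<open>V\<close> (\<open>differential_in_tangent_space\<close>), and a tangent vector is determined
  by its coordinates in one chart, so that \<open>S\<close> is a linear image of a subspace of the coordinate
  space (\<open>tangent_image_eq_span\<close>).
\<close>

section \<open>Orthogonal projection and angles in a subspace with an inner product\<close>

text \<open>Tangent vectors at different points share one type, so the inner product of a tangent space
  is known only relative to a carrier \<open>V\<close>.\<close>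

locale inner_product_on =
  fixes V :: "'v::real_vector set" and b :: "'v \<Rightarrow> 'v \<Rightarrow> real"
  assumes subspace_V: "subspace V"
    and linear_right: "u \<in> V \<Longrightarrow> linear_between V UNIV (b u)"
    and sym: "u \<in> V \<Longrightarrow> v \<in> V \<Longrightarrow> b u v = b v u"
    and pos: "u \<in> V \<Longrightarrow> u \<noteq> 0 \<Longrightarrow> b u u > 0"
begin

lemmas V_closed [simp, intro] =
  subspace_add[OF subspace_V] subspace_diff[OF subspace_V]
  subspace_scale[OF subspace_V] subspace_0[OF subspace_V]

lemma add_right: "u \<in> V \<Longrightarrow> v \<in> V \<Longrightarrow> w \<in> V \<Longrightarrow> b u (v + w) = b u v + b u w"
  and scale_right: "u \<in> V \<Longrightarrow> v \<in> V \<Longrightarrow> b u (a *\<^sub>R v) = a * b u v"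
  using linear_right[of u] by (auto simp: linear_between_def)

lemma diff_right: "u \<in> V \<Longrightarrow> v \<in> V \<Longrightarrow> w \<in> V \<Longrightarrow> b u (v - w) = b u v - b u w"
  using add_right[of u "v - w" w] by auto

lemma zero_right [simp]: "u \<in> V \<Longrightarrow> b u 0 = 0"
  using diff_right[of u 0 0] by auto

lemma add_left: "u \<in> V \<Longrightarrow> v \<in> V \<Longrightarrow> w \<in> V \<Longrightarrow> b (v + w) u = b v u + b w u"
  and scale_left: "u \<in> V \<Longrightarrow> v \<in> V \<Longrightarrow> b (a *\<^sub>R v) u = a * b v u"
  and diff_left: "u \<in> V \<Longrightarrow> v \<in> V \<Longrightarrow> w \<in> V \<Longrightarrow> b (v - w) u = b v u - b w u"
  and zero_left [simp]: "u \<in> V \<Longrightarrow> b 0 u = 0"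
  by (auto simp: sym[of _ u] add_right scale_right diff_right)

lemmas bilinear_simps =
  add_right scale_right diff_right add_left scale_left diff_left

lemma nonneg: "u \<in> V \<Longrightarrow> b u u \<ge> 0"
  using pos[of u] by (cases "u = 0") auto

lemma eq_zero_iff: "u \<in> V \<Longrightarrow> b u u = 0 \<longleftrightarrow> u = 0"
  using pos[of u] by (cases "u = 0") auto

lemma Cauchy_Schwarz:
  assumes "u \<in> V" "v \<in> V"
  shows "\<bar>b u v\<bar> \<le> sqrt (b u u) * sqrt (b v v)"
proof (cases "v = 0")
  case True
  then show ?thesis using assms by simp
next
  case False
  with assms have vv: "b v v > 0" by (simp add: pos)
  define c where "c = b u v / b v v"
  have "0 \<le> b (u - c *\<^sub>R v) (u - c *\<^sub>R v)"
    using assms by (intro nonneg) auto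
  also have "\<dots> = b u u - 2 * c * b u v + c\<^sup>2 * b v v"
    using assms by (simp add: bilinear_simps sym[of v u] power2_eq_square algebra_simps)
  also have "\<dots> = b u u - (b u v)\<^sup>2 / b v v"
    using vv by (simp add: c_def power2_eq_square)
  finally have "(b u v)\<^sup>2 \<le> b u u * b v v"
    using vv by (simp add: field_simps)
  from real_sqrt_le_mono[OF this] show ?thesis
    by (simp add: real_sqrt_mult)
qed

text \<open>Gram-Schmidt: the part \<open>a'\<close> of a new spanning vector \<open>a\<close> that is orthogonal to the span
  so far contributes \<open>(b v a' / b a' a') a'\<close> to the projection of \<open>v\<close>.\<close>

lemma ex_orthogonal_projection:
  assumes "finite B" "B \<subseteq> V" "v \<in> V"
  shows "\<exists>w\<in>span B. \<forall>u\<in>span B. b (v - w) u = 0"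
  using assms
proof (induction arbitrary: v)
  case empty
  then show ?case by auto
next
  case (insert a B)
  have BV: "span B \<subseteq> V"
    using insert.prems subspace_V by (simp add: span_minimal)
  have aV: "a \<in> V" and vV: "v \<in> V" using insert.prems by auto
  from insert.IH[OF _ aV] obtain a0
    where a0: "a0 \<in> span B" "\<And>u. u \<in> span B \<Longrightarrow> b (a - a0) u = 0"
    using insert.prems by auto
  from insert.IH[OF _ vV] obtain w
    where w: "w \<in> span B" "\<And>u. u \<in> span B \<Longrightarrow> b (v - w) u = 0"
    using insert.prems by auto
  define a' where "a' = a - a0"
  have a'V: "a' \<in> V" and wV: "w \<in> V" using a0 w aV BV by (auto simp: a'_def)
  \<comment> \<open>If \<open>a' = 0\<close>, then \<open>c = 0\<close> and \<open>w\<close> itself is the projection.\<close>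
  define c where "c = b v a' / b a' a'"
  have c: "c * b a' a' = b v a'"
    using eq_zero_iff[OF a'V] vV by (cases "a' = 0") (auto simp: c_def)
  have wa': "b w a' = 0"
    using a0(2)[OF w(1)] a'V wV by (simp add: sym a'_def)
  have "a0 \<in> span (insert a B)" "w \<in> span (insert a B)"
    using a0 w span_mono[of B "insert a B"] by auto
  then have mem: "w + c *\<^sub>R a' \<in> span (insert a B)"
    unfolding a'_def by (intro span_add span_scale span_diff) (auto intro: span_base)
  have "b (v - (w + c *\<^sub>R a')) u = 0" if u: "u \<in> span (insert a B)" for u
  proof -
    from u obtain k where "u - k *\<^sub>R a \<in> span B"
      by (auto simp: span_insert)
    then have "u - k *\<^sub>R a + k *\<^sub>R a0 \<in> span B"
      using a0 by (auto intro: span_add span_scale)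
    then obtain s where s: "s \<in> span B" "u = s + k *\<^sub>R a'"
      by (auto simp: a'_def algebra_simps intro!: that[of "u - k *\<^sub>R a + k *\<^sub>R a0"])
    have sV: "s \<in> V" using s BV by auto
    have "b a' s = 0" using a0(2) s by (simp add: a'_def)
    moreover have "b v s - b w s = 0"
      using w(2)[OF s(1)] vV wV sV by (simp add: bilinear_simps)
    ultimately show ?thesis
      using vV wV a'V sV c wa' by (simp add: s(2) bilinear_simps algebra_simps)
  qed
  with mem show ?case by blast
qed

end

locale inner_product_subspace = inner_product_on +
  fixes S :: "'v::real_vector set"
  assumes S_sub: "S \<subseteq> V" and finitely_spanned: "\<exists>B. finite B \<and> S = span B"
begin

abbreviation proj :: "'v \<Rightarrow> 'v" where "proj \<equiv> tangential_part b S"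

lemma subspace_S: "subspace S"
  using finitely_spanned by auto

lemma S_V [simp]: "u \<in> S \<Longrightarrow> u \<in> V"
  using S_sub by auto

lemma projection_unique:
  assumes "v \<in> V" "w \<in> S" "\<And>u. u \<in> S \<Longrightarrow> b (v - w) u = 0"
    and "w' \<in> S" "\<And>u. u \<in> S \<Longrightarrow> b (v - w') u = 0"
  shows "w' = w"
proof -
  have S: "w - w' \<in> S" using assms subspace_S by (simp add: subspace_diff)
  have "b ((v - w') - (v - w)) (w - w') = 0"
    using assms(1,2,4) assms(3)[OF S] assms(5)[OF S] S by (subst diff_left) auto
  then show ?thesis
    using eq_zero_iff[of "w - w'"] S by simp
qed

lemma projI:
  assumes "v \<in> V" "w \<in> S" "\<And>u. u \<in> S \<Longrightarrow> b (v - w) u = 0"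
  shows "proj v = w"
  unfolding tangential_part_def
proof (rule the_equality)
  show "w \<in> S \<and> (\<forall>u\<in>S. b (v - w) u = 0)" using assms by blast
  show "w' = w" if "w' \<in> S \<and> (\<forall>u\<in>S. b (v - w') u = 0)" for w'
    using projection_unique[OF assms] that by blast
qed

lemma proj_properties:
  assumes "v \<in> V"
  shows proj_mem: "proj v \<in> S" and proj_orth: "u \<in> S \<Longrightarrow> b (v - proj v) u = 0"
proof -
  obtain B where B: "finite B" "S = span B" using finitely_spanned by auto
  then have "B \<subseteq> V" using S_sub span_superset by blast
  from ex_orthogonal_projection[OF B(1) this assms] obtain w
    where w: "w \<in> S" "\<And>u. u \<in> S \<Longrightarrow> b (v - w) u = 0" using B by auto
  with projI[OF assms] show "proj v \<in> S" and "u \<in> S \<Longrightarrow> b (v - proj v) u = 0" by auto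
qed

lemma proj_V [simp]: "v \<in> V \<Longrightarrow> proj v \<in> V"
  by (simp add: proj_mem)

lemma proj_adjoint: "v \<in> V \<Longrightarrow> u \<in> S \<Longrightarrow> b v u = b (proj v) u"
  using proj_orth[of v u] by (simp add: diff_left)

lemma proj_add:
  assumes "v \<in> V" "w \<in> V"
  shows "proj (v + w) = proj v + proj w"
proof (rule projI)
  show "proj v + proj w \<in> S"
    using assms by (simp add: proj_mem subspace_add subspace_S)
  show "b (v + w - (proj v + proj w)) u = 0" if "u \<in> S" for u
    using assms that proj_adjoint[of v u] proj_adjoint[of w u] by (simp add: bilinear_simps)
  show "v + w \<in> V" using assms by simp
qed

lemma inner_normal_part:
  assumes "v \<in> V" "w \<in> V"
  shows "b (normal_part b S v) (normal_part b S w) = b v w - b (proj v) (proj w)"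
proof -
  have "b v (proj w) = b (proj v) (proj w)" "b (proj v) w = b (proj v) (proj w)"
    using assms proj_adjoint[of v "proj w"] proj_adjoint[of w "proj v"]
      sym[of "proj v" w] sym[of "proj v" "proj w"] by (simp_all add: proj_mem)
  then show ?thesis
    using assms by (simp add: normal_part_def bilinear_simps)
qed

text \<open>For \<open>w \<in> S\<close> the cosine \<open>b v w / (\<parallel>v\<parallel> \<parallel>w\<parallel>)\<close> equals \<open>b (proj v) w / (\<parallel>v\<parallel> \<parallel>w\<parallel>)\<close>, which by
  Cauchy-Schwarz is largest in the direction of \<open>proj v\<close>; if \<open>proj v = 0\<close>, it is \<open>0\<close> in every
  direction.\<close>

lemma cos_angle_subspace:
  assumes v: "v \<in> V" "v \<noteq> 0" and S: "S \<noteq> {0}"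
  shows "cos (angle_subspace b v S) = sqrt (b (proj v) (proj v)) / sqrt (b v v)"
proof -
  define t where "t = proj v"
  have tS: "t \<in> S" using v by (simp add: t_def proj_mem)
  define n where "n u = sqrt (b u u)" for u
  have n_pos: "n u > 0" if "u \<in> V" "u \<noteq> 0" for u using that pos by (simp add: n_def)
  have n_nonneg: "n u \<ge> 0" if "u \<in> V" for u using that nonneg by (simp add: n_def)
  have CS: "\<bar>b u w\<bar> \<le> n u * n w" if "u \<in> V" "w \<in> V" for u w
    using Cauchy_Schwarz that by (simp add: n_def)
  have n_sq: "n u * n u = b u u" if "u \<in> V" for u
    using that nonneg by (simp add: n_def)
  have bt: "b v w = b t w" if "w \<in> S" for w using that v by (simp add: t_def proj_adjoint)
  define r where "r = n t / n v"
  have "n t * n t \<le> n v * n t"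
    using CS[of v t] bt[OF tS] v tS by (simp add: n_sq)
  then have "n t \<le> n v"
    using n_nonneg[of t] n_nonneg[of v] v tS by (cases "n t = 0") auto
  then have r: "0 \<le> r" "r \<le> 1"
    using n_pos[OF v] n_nonneg[of t] tS by (auto simp: r_def)
  have lower: "arccos r \<le> angle b v w" if w: "w \<in> S - {0}" for w
  proof -
    have vw: "n v * n w > 0" using w n_pos v by simp
    have "b v w / (n v * n w) \<le> n t * n w / (n v * n w)"
      using CS[of t w] bt[of w] w tS vw by (intro divide_right_mono) auto
    then have "b v w / (n v * n w) \<le> r" using w n_pos[of w] by (simp add: r_def)
    moreover have "-1 \<le> b v w / (n v * n w)"
      using CS[of v w] w v vw by (simp add: field_simps)
    ultimately show ?thesis
      using r by (auto simp: angle_def n_def intro!: arccos_le_arccos)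
  qed
  have "\<exists>w\<in>S - {0}. angle b v w = arccos r"
  proof (cases "t = 0")
    case True
    obtain w where "w \<in> S - {0}" using S subspace_0[OF subspace_S] by auto
    moreover have "b v w = 0" using True bt[of w] \<open>w \<in> S - {0}\<close> by simp
    ultimately show ?thesis
      using True by (intro bexI[of _ w]) (auto simp: angle_def r_def n_def)
  next
    case False
    have "b v t = n t * n t" using bt[OF tS] n_sq[of t] tS by simp
    then have "b v t / (n v * n t) = r"
      using n_pos[of t] False tS by (simp add: r_def)
    with False tS show ?thesis by (auto simp: angle_def n_def)
  qed
  then have "arccos r \<in> angle b v ` (S - {0})" by (metis imageI)
  then have "angle_subspace b v S = arccos r"
    unfolding angle_subspace_def by (rule cInf_eq_minimum) (use lower in auto)
  moreover have "cos (arccos r) = r" using r by (intro cos_arccos) auto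
  ultimately show ?thesis by (simp only: r_def t_def n_def)
qed

text \<open>Since \<open>J (J v) = p J v + q v\<close> with \<open>q \<noteq> 0\<close>, the operator \<open>J\<close> is injective, so \<open>J w\<close> makes an
  angle with \<open>S\<close> whenever \<open>w \<noteq> 0\<close>. The auxiliary form \<open>B u v = b (proj (J u)) (proj (J v)) -
  cos\<^sup>2 \<theta> b (J u) (J v)\<close> is symmetric, biadditive and vanishes on the diagonal of \<open>S\<close>, so it
  vanishes on \<open>S\<close>.\<close>

lemma slant_projection_identities:
  fixes p q :: nat
  assumes J: "linear_between V V J" and "q > 0"
    and metallic: "\<And>v. v \<in> V \<Longrightarrow> J (J v) = real p *\<^sub>R J v + real q *\<^sub>R v"
    and self_adjoint: "\<And>u v. u \<in> V \<Longrightarrow> v \<in> V \<Longrightarrow> b (J u) v = b u (J v)"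
    and slant: "\<And>w. w \<in> S \<Longrightarrow> w \<noteq> 0 \<Longrightarrow> angle_subspace b (J w) S = \<theta>"
    and u: "u \<in> S" and v: "v \<in> S"
  shows "b (proj (J u)) (proj (J v)) = (cos \<theta>)\<^sup>2 * (real p * b u (J v) + real q * b u v)"
    and "b (normal_part b S (J u)) (normal_part b S (J v)) =
      (sin \<theta>)\<^sup>2 * (real p * b u (J v) + real q * b u v)"
proof -
  have JV [simp]: "J w \<in> V" if "w \<in> V" for w using J that by (auto simp: linear_between_def)
  have J_add: "J (w + z) = J w + J z" if "w \<in> V" "z \<in> V" for w z
    using J that by (auto simp: linear_between_def)
  have J_0: "J 0 = 0" using J_add[of 0 0] by simp
  define B where "B w z = b (proj (J w)) (proj (J z)) - (cos \<theta>)\<^sup>2 * b (J w) (J z)" for w z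
  have diag: "B w w = 0" if w: "w \<in> S" for w
  proof (cases "w = 0")
    case True
    then show ?thesis
      using J_0 proj_add[of 0 0] by (simp add: B_def)
  next
    case False
    have "J w \<noteq> 0"
      using metallic[of w] J_0 w False \<open>q > 0\<close> by auto
    then have "cos \<theta> = sqrt (b (proj (J w)) (proj (J w))) / sqrt (b (J w) (J w))"
      using cos_angle_subspace[of "J w"] slant[OF w False] w False by auto
    moreover have "b (J w) (J w) > 0" using \<open>J w \<noteq> 0\<close> w by (simp add: pos)
    ultimately show ?thesis
      using w by (simp add: B_def power_divide nonneg)
  qed
  have "B (u + v) (u + v) = B u u + 2 * B u v + B v v"
    using u v sym[of "J v" "J u"] sym[of "proj (J v)" "proj (J u)"]
    by (simp add: B_def J_add proj_add bilinear_simps algebra_simps)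
  then have "B u v = 0"
    using diag[of u] diag[of v] diag[of "u + v"] u v subspace_S by (simp add: subspace_add)
  moreover have JJ: "b (J u) (J v) = real p * b u (J v) + real q * b u v"
    using u v self_adjoint[of u "J v"] by (simp add: metallic bilinear_simps)
  ultimately show *: "b (proj (J u)) (proj (J v)) =
      (cos \<theta>)\<^sup>2 * (real p * b u (J v) + real q * b u v)"
    by (simp add: B_def)
  show "b (normal_part b S (J u)) (normal_part b S (J v)) =
      (sin \<theta>)\<^sup>2 * (real p * b u (J v) + real q * b u v)"
    using u v by (simp add: inner_normal_part * JJ sin_squared_eq algebra_simps)
qed

end

section \<open>Tangent spaces and differentials\<close>

lemma smooth_on_differentiable: "smooth_on S f \<Longrightarrow> x \<in> S \<Longrightarrow> f differentiable (at x)"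
  using Ck_on.simps(2)[of 0 S f] by (auto simp: smooth_on_def)

lemma chart_inv_inverse:
  assumes "chart_on X c" "x \<in> fst c"
  shows "chart_inv c (snd c x) = x"
proof -
  have "topspace (subtopology X (fst c)) = fst c"
    using assms openin_subset[of X "fst c"] by (auto simp: chart_on_def)
  then have "inj_on (snd c) (fst c)"
    using assms homeomorphic_imp_injective_map by (fastforce simp: chart_on_def)
  then show ?thesis using assms by (simp add: chart_inv_def)
qed

lemma chart_image_open:
  assumes c: "chart_on X c" and "openin X U"
  shows "open (snd c ` (fst c \<inter> U))"
proof -
  have "open_map (subtopology X (fst c)) (top_of_set (snd c ` fst c)) (snd c)"
    using c by (simp add: chart_on_def homeomorphic_imp_open_map)
  moreover have "openin (subtopology X (fst c)) (fst c \<inter> U)"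
    using assms by (auto simp: chart_on_def openin_subtopology_Int2)
  ultimately have "openin (top_of_set (snd c ` fst c)) (snd c ` (fst c \<inter> U))"
    by (auto simp: open_map_def)
  then show ?thesis
    using c openin_open_trans by (auto simp: chart_on_def)
qed

lemma charts_at_nonempty:
  "smooth_manifold M \<Longrightarrow> x \<in> topspace (mtop M) \<Longrightarrow> \<exists>c. c \<in> charts_at M x"
  unfolding smooth_manifold_def charts_at_def by blast

lemma linear_transition:
  assumes "smooth_manifold M" "c \<in> charts_at M x" "d \<in> charts_at M x"
  shows "linear (frechet_derivative (snd d \<circ> chart_inv c) (at (snd c x)))"
proof (rule linear_frechet_derivative, rule smooth_on_differentiable)
  show "smooth_on (snd c ` (fst c \<inter> fst d)) (snd d \<circ> chart_inv c)"
    using assms by (auto simp: smooth_manifold_def charts_at_def)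
qed (use assms in \<open>auto simp: charts_at_def\<close>)

lemma subspace_tangent_space:
  fixes M :: "('p, 'e::euclidean_space) manifold"
  assumes "smooth_manifold M"
  shows "subspace (tangent_space M x)"
proof -
  define F where "F c d = frechet_derivative (snd d \<circ> chart_inv c) (at (snd c x))"
    for c d :: "('p, 'e) chart"
  have lin: "linear (F c d)" if "c \<in> charts_at M x" "d \<in> charts_at M x" for c d
    unfolding F_def using linear_transition[OF assms that] .
  have mem: "v \<in> tangent_space M x \<longleftrightarrow> (\<forall>c. c \<notin> charts_at M x \<longrightarrow> v c = 0) \<and>
      (\<forall>c\<in>charts_at M x. \<forall>d\<in>charts_at M x. F c d (v c) = v d)" for v
    unfolding tangent_space_def F_def mem_Collect_eq
    by (intro conj_cong ball_cong refl eq_commute)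
  show ?thesis
    by (rule subspaceI)
      (simp_all add: mem linear_0[OF lin] linear_add[OF lin] linear_cmul[OF lin])
qed

lemma local_map_differentiable:
  assumes "smooth_map M N f" "c \<in> charts_at M x" "d \<in> charts_at N (f x)"
  shows "(snd d \<circ> f \<circ> chart_inv c) differentiable (at (snd c x))"
proof (rule smooth_on_differentiable)
  show "smooth_on (snd c ` (fst c \<inter> f -` fst d)) (snd d \<circ> f \<circ> chart_inv c)"
    using assms by (auto simp: smooth_map_def charts_at_def)
qed (use assms in \<open>auto simp: charts_at_def\<close>)

text \<open>The coordinates of \<open>f\<close> in two charts \<open>d\<close>, \<open>d'\<close> of the target differ by a transition map
  near the point in question, namely on the coordinate image of the open set where \<open>f\<close> takes
  values in the domain of \<open>d\<close>.\<close>

lemma local_map_change_of_chart: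
  assumes M: "smooth_manifold M" and N: "smooth_manifold N" and f: "smooth_map M N f"
    and c: "c \<in> charts_at M x" and d: "d \<in> charts_at N (f x)" and d': "d' \<in> charts_at N (f x)"
  shows "frechet_derivative (snd d' \<circ> f \<circ> chart_inv c) (at (snd c x)) a =
    frechet_derivative (snd d' \<circ> chart_inv d) (at (snd d (f x)))
      (frechet_derivative (snd d \<circ> f \<circ> chart_inv c) (at (snd c x)) a)"
proof -
  have charts: "chart_on (mtop M) c" "chart_on (mtop N) d" "x \<in> fst c" "f x \<in> fst d"
    using M N c d by (auto simp: smooth_manifold_def charts_at_def)
  let ?F = "snd d \<circ> f \<circ> chart_inv c" and ?G = "snd d' \<circ> chart_inv d"
  let ?U = "{z \<in> topspace (mtop M). f z \<in> fst d}"
  let ?W = "snd c ` (fst c \<inter> ?U)"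
  have Fx: "?F (snd c x) = snd d (f x)"
    using charts by (simp add: chart_inv_inverse)
  have "smooth_on (snd d ` (fst d \<inter> fst d')) ?G"
    using N d d' by (auto simp: smooth_manifold_def charts_at_def)
  then have "?G differentiable (at (?F (snd c x)))"
    unfolding Fx by (rule smooth_on_differentiable) (use d d' in \<open>auto simp: charts_at_def\<close>)
  then have "(?G has_derivative frechet_derivative ?G (at (?F (snd c x)))) (at (?F (snd c x)))"
    using frechet_derivative_works by blast
  moreover have "(?F has_derivative frechet_derivative ?F (at (snd c x))) (at (snd c x))"
    using local_map_differentiable[OF f c d] frechet_derivative_works by blast
  ultimately have comp: "(?G \<circ> ?F has_derivative
      frechet_derivative ?G (at (?F (snd c x))) \<circ> frechet_derivative ?F (at (snd c x)))
      (at (snd c x))"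
    by (rule diff_chain_at[rotated])
  have "openin (mtop M) ?U"
    using f charts by (auto simp: smooth_map_def chart_on_def intro: openin_continuous_map_preimage)
  then have "open ?W" by (rule chart_image_open[OF charts(1)])
  moreover have "snd c x \<in> ?W"
    using charts openin_subset[of "mtop M" "fst c"] by (auto simp: chart_on_def)
  moreover have "(?G \<circ> ?F) y = (snd d' \<circ> f \<circ> chart_inv c) y" if "y \<in> ?W" for y
    using that charts by (auto simp: chart_inv_inverse)
  ultimately have "(snd d' \<circ> f \<circ> chart_inv c has_derivative
      frechet_derivative ?G (at (?F (snd c x))) \<circ> frechet_derivative ?F (at (snd c x)))
      (at (snd c x))"
    using comp by (rule has_derivative_transform_within_open[rotated])
  from fun_cong[OF frechet_derivative_at[OF this], of a] show ?thesis
    unfolding Fx by (simp only: comp_apply)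
qed

lemma differential_in_tangent_space:
  assumes "smooth_manifold M" "smooth_manifold N" "smooth_map M N f" "x \<in> topspace (mtop M)"
  shows "differential M N f x v \<in> tangent_space N (f x)"
proof -
  have "(SOME c. c \<in> charts_at M x) \<in> charts_at M x"
    using charts_at_nonempty[OF assms(1,4)] by (auto intro: someI_ex)
  note change = local_map_change_of_chart[OF assms(1-3) this]
  show ?thesis
    unfolding tangent_space_def mem_Collect_eq differential_def Let_def
  proof (intro conjI ballI allI impI, goal_cases)
    case (2 d d')
    show ?case
      unfolding if_P[OF 2(1)] if_P[OF 2(2)] by (rule change[OF 2])
  qed simp
qed

text \<open>The chart chosen by \<open>differential\<close> does not depend on the tangent vector, so all tangent
  vectors at \<open>x\<close> are mapped through the same coordinates.\<close>

lemma differential_factors_through_chart: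
  fixes f :: "'p \<Rightarrow> 'q"
    and M :: "('p, 'e::euclidean_space) manifold" and N :: "('q, 'f::euclidean_space) manifold"
  assumes M: "smooth_manifold M" and f: "smooth_map M N f" and x: "x \<in> topspace (mtop M)"
  obtains c F where "linear (F :: 'e \<Rightarrow> ('q, 'f) tvec)" "differential M N f x = (\<lambda>v. F (v c))"
proof -
  define c where "c = (SOME c. c \<in> charts_at M x)"
  have c: "c \<in> charts_at M x"
    unfolding c_def using charts_at_nonempty[OF M x] by (auto intro: someI_ex)
  define F where "F a = (\<lambda>d. if d \<in> charts_at N (f x)
    then frechet_derivative (snd d \<circ> f \<circ> chart_inv c) (at (snd c x)) a else 0)" for a
  have lin: "linear (frechet_derivative (snd d \<circ> f \<circ> chart_inv c) (at (snd c x)))"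
    if "d \<in> charts_at N (f x)" for d
    by (rule linear_frechet_derivative[OF local_map_differentiable[OF f c that]])
  have "linear F"
    by (intro linearI ext) (simp_all add: F_def linear_add[OF lin] linear_cmul[OF lin])
  moreover have "differential M N f x = (\<lambda>v. F (v c))"
    by (simp add: differential_def F_def c_def Let_def fun_eq_iff)
  ultimately show thesis by (rule that)
qed

lemma differential_zero:
  fixes M :: "('p, 'e::euclidean_space) manifold" and N :: "('q, 'f::euclidean_space) manifold"
  assumes "smooth_manifold M" "smooth_map M N f" "x \<in> topspace (mtop M)"
  shows "differential M N f x 0 = 0"
proof -
  obtain c and F :: "'e \<Rightarrow> ('q, 'f) tvec"
    where "linear F" "differential M N f x = (\<lambda>v. F (v c))"
    using differential_factors_through_chart[OF assms] .
  then show ?thesis by (simp add: linear_0)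
qed

text \<open>The coordinates of the tangent vectors in one chart form a subspace of the Euclidean
  coordinate space, which is finitely spanned, and the differential factors through them.\<close>

lemma tangent_image_eq_span:
  fixes f :: "'p \<Rightarrow> 'q"
    and M :: "('p, 'e::euclidean_space) manifold" and N :: "('q, 'f::euclidean_space) manifold"
  assumes M: "smooth_manifold M" and f: "smooth_map M N f" and x: "x \<in> topspace (mtop M)"
  shows "\<exists>B. finite B \<and> tangent_image M N f x = span B"
proof -
  obtain c and F :: "'e \<Rightarrow> ('q, 'f) tvec"
    where F: "linear F" and D: "differential M N f x = (\<lambda>v. F (v c))"
    using differential_factors_through_chart[OF M f x] .
  let ?A = "(\<lambda>v. v c) ` tangent_space M x"
  have "linear (\<lambda>v :: ('p, 'e) tvec. v c)" by (rule linearI) auto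
  then have "subspace ?A"
    using subspace_tangent_space[OF M] by (rule linear_subspace_image)
  then have "span ?A = ?A" by (simp only: span_eq_iff)
  moreover obtain B where B: "finite B" "span B = span ?A"
    by (metis basis_exists independent_imp_finite span_eq span_superset subset_trans)
  ultimately have "tangent_image M N f x = F ` span B"
    by (simp only: tangent_image_def D image_image)
  then have "tangent_image M N f x = span (F ` B)"
    by (simp only: linear_span_image[OF F])
  with B show ?thesis by blast
qed

section \<open>Slant submanifolds of metallic Riemannian manifolds\<close>

theorem proposition3p21:
  fixes M :: "('p, 'e::euclidean_space) manifold"
    and N :: "('q, 'f::euclidean_space) manifold"
    and h :: "'p \<Rightarrow> ('p, 'e) tvec \<Rightarrow> ('p, 'e) tvec \<Rightarrow> real"
    and g :: "'q \<Rightarrow> ('q, 'f) tvec \<Rightarrow> ('q, 'f) tvec \<Rightarrow> real"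
    and J :: "'q \<Rightarrow> ('q, 'f) tvec \<Rightarrow> ('q, 'f) tvec"
    and f :: "'p \<Rightarrow> 'q"
    and p q :: nat
    and \<theta> :: real
    and X Y :: "'p \<Rightarrow> ('p, 'e) tvec"
  assumes "metallic_riemannian_manifold N p q J g"
    and "isometric_immersion M h N g f"
    and "slant_submanifold M N f J g \<theta>"
    and "vector_field M X"
    and "vector_field M Y"
  shows "\<forall>x\<in>topspace (mtop M).
           g (f x) (T_op M N f J g X x) (T_op M N f J g Y x) =
             (cos \<theta>)\<^sup>2 *
               (real p * g (f x) (differential M N f x (X x)) (J (f x) (differential M N f x (Y x))) +
                real q * g (f x) (differential M N f x (X x)) (differential M N f x (Y x))) \<and>
           g (f x) (N_op M N f J g X x) (N_op M N f J g Y x) =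
             (sin \<theta>)\<^sup>2 *
               (real p * g (f x) (differential M N f x (X x)) (J (f x) (differential M N f x (Y x))) +
                real q * g (f x) (differential M N f x (X x)) (differential M N f x (Y x)))"
proof
  fix x assume x: "x \<in> topspace (mtop M)"
  have M: "smooth_manifold M" and N: "smooth_manifold N" and metric: "riemannian_metric N g"
    and f: "smooth_map M N f"
    using assms(2) by (auto simp: isometric_immersion_def riemannian_manifold_def immersion_def)
  have fx: "f x \<in> topspace (mtop N)"
    using f x by (auto simp: smooth_map_def continuous_map_def)
  let ?V = "tangent_space N (f x)" and ?S = "tangent_image M N f x"
  interpret inner_product_subspace ?V "g (f x)" ?S
  proof
    show "subspace ?V" by (rule subspace_tangent_space[OF N])
    show "?S \<subseteq> ?V"
      using differential_in_tangent_space[OF M N f x] by (auto simp: tangent_image_def)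
    show "\<exists>B. finite B \<and> ?S = span B" by (rule tangent_image_eq_span[OF M f x])
  qed (use metric fx in \<open>auto simp: riemannian_metric_def\<close>)
  have slant: "angle_subspace (g (f x)) (J (f x) w) ?S = \<theta>" if "w \<in> ?S" "w \<noteq> 0" for w
  proof -
    from \<open>w \<in> ?S\<close> obtain u where u: "u \<in> tangent_space M x" "w = differential M N f x u"
      by (auto simp: tangent_image_def)
    moreover have "u \<noteq> 0" using differential_zero[OF M f x] u \<open>w \<noteq> 0\<close> by auto
    ultimately show ?thesis using assms(3) x by (auto simp: slant_submanifold_def)
  qed
  have "differential M N f x (X x) \<in> ?S" "differential M N f x (Y x) \<in> ?S"
    using assms(4,5) x by (auto simp: vector_field_def tangent_image_def)
  moreover have "linear_between ?V ?V (J (f x))" "q > 0"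
    "\<And>v. v \<in> ?V \<Longrightarrow> J (f x) (J (f x) v) = real p *\<^sub>R J (f x) v + real q *\<^sub>R v"
    "\<And>u v. u \<in> ?V \<Longrightarrow> v \<in> ?V \<Longrightarrow> g (f x) (J (f x) u) v = g (f x) u (J (f x) v)"
    using assms(1) fx by (auto simp: metallic_riemannian_manifold_def tensor_field_1_1_def)
  note identities = slant_projection_identities[OF this slant]
  ultimately show "g (f x) (T_op M N f J g X x) (T_op M N f J g Y x) =
             (cos \<theta>)\<^sup>2 *
               (real p * g (f x) (differential M N f x (X x)) (J (f x) (differential M N f x (Y x))) +
                real q * g (f x) (differential M N f x (X x)) (differential M N f x (Y x))) \<and>
           g (f x) (N_op M N f J g X x) (N_op M N f J g Y x) =
             (sin \<theta>)\<^sup>2 *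
               (real p * g (f x) (differential M N f x (X x)) (J (f x) (differential M N f x (Y x))) +
                real q * g (f x) (differential M N f x (X x)) (differential M N f x (Y x)))"
    unfolding T_op_def N_op_def by (intro conjI identities)
qed

end
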